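(* Let $\Gamma$ be a finite group and let $T$ be a finite connected right $\Gamma$-graph with at least one edge. Suppose that $T$ is stiff. Then the map $\Gamma \to \mathrm{Sing}(T,T)$, $\gamma\mapsto\alpha_\gamma$, is a $\Gamma$-weak equivalence if and only if the homomorphism $\alpha : \Gamma \to \mathrm{Aut}(T)$, $\gamma\mapsto\alpha_\gamma$, is an isomorphism and every endomorphism of $T$ is an automorphism. Here $\alpha_\gamma : T\to T$ is $v\mapsto v\gamma$.
   Context: A graph is a pair $G=(V(G),E(G))$ of a set $V(G)$ and a symmetric subset $E(G) \subset V(G)\times V(G)$ (loops allowed). Graph homomorphisms are vertex maps sending edges to edges; endomorphisms of $T$ are graph homomorphisms $T\to T$. $\mathrm{Aut}(T)$ is the automorphism group of $T$, with product $f\cdot g := g\circ f$ (the convention for which a right action of $\Gamma$ gives a homomorphism $\alpha$). A right $\Gamma$-graph is a graph with a right action of $\Gamma$ by graph automorphisms. For a vertex $v$, $N(v)$ is the set of vertices adjacent to $v$. A vertex $v$ is dismantlable if there is another vertex $w\neq v$ with $N(v)\subset N(w)$; a graph is stiff if it has no dismantlable vertices. The product $G\times H$ has vertex set $V(G)\times V(H)$, with $(x,y)$ adjacent to $(x',y')$ iff $(x,x')\in E(G)$ and $(y,y')\in E(H)$. $\Sigma^n$ is the graph with $V(\Sigma^n)=\{0,\dots,n\}$ and all pairs (including loops) as edges. $\mathrm{Sing}(T,G)$ is the simplicial set whose $n$-simplices are the graph homomorphisms $T\times\Sigma^n\to G$, with left $\Gamma$-action $(\gamma f)(v,i)=f(v\gamma,i)$;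 its $0$-simplices are identified with graph homomorphisms $T\to G$. $\Gamma$ is regarded as a discrete simplicial set (its elements are the 0-simplices and there are no other non-degenerate simplices) with the left translation action. A $\Gamma$-simplicial map $f:K\to L$ is a $\Gamma$-weak equivalence if $f^{\Gamma'}:K^{\Gamma'}\to L^{\Gamma'}$ is a weak equivalence of simplicial sets for every subgroup $\Gamma'\le\Gamma$. *)

theory Defs
  imports "HOL-Homology.Simplices" "HOL-Algebra.Group"
begin

section \<open>Graphs\<close>

record 'v ugraph =
  gverts :: "'v set"
  gedges :: "('v \<times> 'v) set"

definition is_graph :: "'v ugraph \<Rightarrow> bool" where
  "is_graph G \<longleftrightarrow> gedges G \<subseteq> gverts G \<times> gverts G \<and> sym (gedges G)"

text \<open>Vertex maps are extensional functions on the vertex set, so that equality of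
  homomorphisms is equality of vertex maps.\<close>

definition graph_hom :: "'v ugraph \<Rightarrow> 'w ugraph \<Rightarrow> ('v \<Rightarrow> 'w) set" where
  "graph_hom G H =
     {f \<in> gverts G \<rightarrow>\<^sub>E gverts H. \<forall>(u, v) \<in> gedges G. (f u, f v) \<in> gedges H}"

definition graph_auts :: "'v ugraph \<Rightarrow> ('v \<Rightarrow> 'v) set" where
  "graph_auts G =
     {f \<in> graph_hom G G. \<exists>g \<in> graph_hom G G.
        compose (gverts G) g f = (\<lambda>v\<in>gverts G. v) \<and>
        compose (gverts G) f g = (\<lambda>v\<in>gverts G. v)}"

text \<open>The product is \<open>f \<cdot> g = g \<circ> f\<close>, so that right actions correspond to homomorphisms.\<close>

definition Aut :: "'v ugraph \<Rightarrow> ('v \<Rightarrow> 'v) monoid" where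
  "Aut G = \<lparr>carrier = graph_auts G, mult = (\<lambda>f g. compose (gverts G) g f),
            one = (\<lambda>v\<in>gverts G. v)\<rparr>"

definition graph_connected :: "'v ugraph \<Rightarrow> bool" where
  "graph_connected G \<longleftrightarrow>
     gverts G \<noteq> {} \<and> (\<forall>u\<in>gverts G. \<forall>v\<in>gverts G. (u, v) \<in> (gedges G)\<^sup>*)"

definition nbhd :: "'v ugraph \<Rightarrow> 'v \<Rightarrow> 'v set" where
  "nbhd G v = {w \<in> gverts G. (v, w) \<in> gedges G}"

definition dismantlable :: "'v ugraph \<Rightarrow> 'v \<Rightarrow> bool" where
  "dismantlable G v \<longleftrightarrow> (\<exists>w\<in>gverts G. w \<noteq> v \<and> nbhd G v \<subseteq> nbhd G w)"

definition stiff :: "'v ugraph \<Rightarrow> bool" where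
  "stiff G \<longleftrightarrow> \<not> (\<exists>v\<in>gverts G. dismantlable G v)"

definition graph_prod :: "'v ugraph \<Rightarrow> 'w ugraph \<Rightarrow> ('v \<times> 'w) ugraph" where
  "graph_prod G H =
     \<lparr>gverts = gverts G \<times> gverts H,
      gedges = {((x, y), (x', y')) | x y x' y'. (x, x') \<in> gedges G \<and> (y, y') \<in> gedges H}\<rparr>"

definition Sigma_graph :: "nat \<Rightarrow> nat ugraph" where
  "Sigma_graph n = \<lparr>gverts = {..n}, gedges = {..n} \<times> {..n}\<rparr>"

text \<open>\<open>ra v \<gamma>\<close> is \<open>v\<gamma>\<close>, and \<open>act_hom T ra \<gamma>\<close> is \<open>\<alpha>\<^sub>\<gamma>\<close>.\<close>

definition act_hom :: "'v ugraph \<Rightarrow> ('v \<Rightarrow> 'g \<Rightarrow> 'v) \<Rightarrow> 'g \<Rightarrow> ('v \<Rightarrow> 'v)" where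
  "act_hom T ra \<gamma> = (\<lambda>v\<in>gverts T. ra v \<gamma>)"

definition right_graph_action ::
    "('g, 'b) monoid_scheme \<Rightarrow> 'v ugraph \<Rightarrow> ('v \<Rightarrow> 'g \<Rightarrow> 'v) \<Rightarrow> bool" where
  "right_graph_action \<Gamma> T ra \<longleftrightarrow>
     (\<forall>\<gamma>\<in>carrier \<Gamma>. act_hom T ra \<gamma> \<in> graph_auts T) \<and>
     (\<forall>v\<in>gverts T. ra v \<one>\<^bsub>\<Gamma>\<^esub> = v) \<and>
     (\<forall>\<gamma>\<in>carrier \<Gamma>. \<forall>\<delta>\<in>carrier \<Gamma>. \<forall>v\<in>gverts T. ra v (\<gamma> \<otimes>\<^bsub>\<Gamma>\<^esub> \<delta>) = ra (ra v \<gamma>) \<delta>)"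


section \<open>Simplicial sets\<close>

text \<open>Morphisms \<open>[m] \<rightarrow> [n]\<close> of the simplex category.\<close>

definition ord_maps :: "nat \<Rightarrow> nat \<Rightarrow> (nat \<Rightarrow> nat) set" where
  "ord_maps m n = {\<theta> \<in> {..m} \<rightarrow>\<^sub>E {..n}. mono_on {..m} \<theta>}"

text \<open>A simplicial set is a contravariant functor on the simplex category:
  \<open>pull K m n \<theta> : K\<^sub>n \<rightarrow> K\<^sub>m\<close> is \<open>\<theta>\<^sup>*\<close> for \<open>\<theta> : [m] \<rightarrow> [n]\<close>.\<close>

record 'a simp_set =
  simps_of :: "nat \<Rightarrow> 'a set"
  pull :: "nat \<Rightarrow> nat \<Rightarrow> (nat \<Rightarrow> nat) \<Rightarrow> 'a \<Rightarrow> 'a"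

definition is_simp_set :: "('a, 'x) simp_set_scheme \<Rightarrow> bool" where
  "is_simp_set K \<longleftrightarrow>
     (\<forall>m n. \<forall>\<theta>\<in>ord_maps m n. \<forall>x\<in>simps_of K n. pull K m n \<theta> x \<in> simps_of K m) \<and>
     (\<forall>n. \<forall>x\<in>simps_of K n. pull K n n (\<lambda>i\<in>{..n}. i) x = x) \<and>
     (\<forall>l m n. \<forall>\<phi>\<in>ord_maps l m. \<forall>\<theta>\<in>ord_maps m n. \<forall>x\<in>simps_of K n.
        pull K l m \<phi> (pull K m n \<theta> x) = pull K l n (compose {..l} \<theta> \<phi>) x)"

definition is_simp_map ::
    "('a, 'x) simp_set_scheme \<Rightarrow> ('c, 'y) simp_set_scheme \<Rightarrow> (nat \<Rightarrow> 'a \<Rightarrow> 'c) \<Rightarrow> bool" where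
  "is_simp_map K L f \<longleftrightarrow>
     (\<forall>n. \<forall>x\<in>simps_of K n. f n x \<in> simps_of L n) \<and>
     (\<forall>m n. \<forall>\<theta>\<in>ord_maps m n. \<forall>x\<in>simps_of K n.
        f m (pull K m n \<theta> x) = pull L m n \<theta> (f n x))"


subsection \<open>Geometric realization\<close>

text \<open>Points of the coproduct of the \<open>K\<^sub>n \<times> \<Delta>\<^sup>n\<close> are triples \<open>(n, x, t)\<close>.\<close>

definition pre_realization :: "('a, 'x) simp_set_scheme \<Rightarrow> (nat \<times> 'a \<times> (nat \<Rightarrow> real)) topology" where
  "pre_realization K =
     sum_topology
       (\<lambda>n. prod_topology (discrete_topology (simps_of K n))
              (subtopology (powertop_real UNIV) (standard_simplex n)))
       UNIV"

text \<open>The affine map \<open>\<Delta>\<^sup>m \<rightarrow> \<Delta>\<^sup>n\<close> induced by \<open>\<theta> : [m] \<rightarrow> [n]\<close> on vertices.\<close>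

definition simplex_push :: "nat \<Rightarrow> (nat \<Rightarrow> nat) \<Rightarrow> (nat \<Rightarrow> real) \<Rightarrow> (nat \<Rightarrow> real)" where
  "simplex_push m \<theta> t = (\<lambda>j. \<Sum>i\<in>{i \<in> {..m}. \<theta> i = j}. t i)"

definition realization_step ::
    "('a, 'x) simp_set_scheme \<Rightarrow> (nat \<times> 'a \<times> (nat \<Rightarrow> real)) rel" where
  "realization_step K =
     {((m, pull K m n \<theta> x, t), (n, x, simplex_push m \<theta> t)) | m n \<theta> x t.
        \<theta> \<in> ord_maps m n \<and> x \<in> simps_of K n \<and> t \<in> standard_simplex m}"

definition realization_class ::
    "('a, 'x) simp_set_scheme \<Rightarrow> nat \<times> 'a \<times> (nat \<Rightarrow> real) \<Rightarrow> (nat \<times> 'a \<times> (nat \<Rightarrow> real)) set" where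
  "realization_class K p = (realization_step K \<union> (realization_step K)\<inverse>)\<^sup>* `` {p}"

text \<open>The quotient topology on the set of classes.\<close>

definition realization ::
    "('a, 'x) simp_set_scheme \<Rightarrow> (nat \<times> 'a \<times> (nat \<Rightarrow> real)) set topology" where
  "realization K =
     topology (\<lambda>U. U \<subseteq> realization_class K ` topspace (pre_realization K) \<and>
       openin (pre_realization K)
         {p \<in> topspace (pre_realization K). realization_class K p \<in> U})"

lemma openin_realization:
  "openin (realization K) U \<longleftrightarrow>
     U \<subseteq> realization_class K ` topspace (pre_realization K) \<and>
     openin (pre_realization K) {p \<in> topspace (pre_realization K). realization_class K p \<in> U}"
proof -
  let ?S = "topspace (pre_realization K)" and ?c = "realization_class K"
  have "istopology (\<lambda>U. U \<subseteq> ?c ` ?S \<and> openin (pre_realization K) {p \<in> ?S. ?c p \<in> U})"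
    unfolding istopology_def
  proof (rule conjI; intro allI impI)
    fix U V
    assume "U \<subseteq> ?c ` ?S \<and> openin (pre_realization K) {p \<in> ?S. ?c p \<in> U}"
      "V \<subseteq> ?c ` ?S \<and> openin (pre_realization K) {p \<in> ?S. ?c p \<in> V}"
    moreover have "{p \<in> ?S. ?c p \<in> U \<inter> V} = {p \<in> ?S. ?c p \<in> U} \<inter> {p \<in> ?S. ?c p \<in> V}"
      by blast
    ultimately show "U \<inter> V \<subseteq> ?c ` ?S \<and> openin (pre_realization K) {p \<in> ?S. ?c p \<in> U \<inter> V}"
      by auto
  next
    fix \<U>
    assume A: "\<forall>U\<in>\<U>. U \<subseteq> ?c ` ?S \<and> openin (pre_realization K) {p \<in> ?S. ?c p \<in> U}"
    have "{p \<in> ?S. ?c p \<in> \<Union>\<U>} = \<Union>((\<lambda>U. {p \<in> ?S. ?c p \<in> U}) ` \<U>)" by blast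
    with A show "\<Union>\<U> \<subseteq> ?c ` ?S \<and> openin (pre_realization K) {p \<in> ?S. ?c p \<in> \<Union>\<U>}"
      by auto
  qed
  then show ?thesis by (simp add: realization_def)
qed

lemma quotient_map_realization:
  "quotient_map (pre_realization K) (realization K) (realization_class K)"
proof -
  let ?S = "topspace (pre_realization K)" and ?c = "realization_class K"
  have "{p \<in> ?S. ?c p \<in> ?c ` ?S} = ?S" by blast
  then have "openin (realization K) (?c ` ?S)"
    by (simp add: openin_realization)
  then have "?c ` ?S \<subseteq> topspace (realization K)"
    by (rule openin_subset)
  moreover have "topspace (realization K) \<subseteq> ?c ` ?S"
    using openin_realization openin_topspace by blast
  ultimately have "topspace (realization K) = ?c ` ?S" by blast
  then show ?thesis unfolding quotient_map_def openin_realization by blast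
qed

definition realization_map ::
    "('c, 'y) simp_set_scheme \<Rightarrow> (nat \<Rightarrow> 'a \<Rightarrow> 'c)
      \<Rightarrow> (nat \<times> 'a \<times> (nat \<Rightarrow> real)) set \<Rightarrow> (nat \<times> 'c \<times> (nat \<Rightarrow> real)) set" where
  "realization_map L f C = (\<Union>(n, x, t)\<in>C. realization_class L (n, f n x, t))"

lemma realization_class_eq:
  assumes "q \<in> realization_class K p"
  shows "realization_class K q = realization_class K p"
proof -
  let ?R = "(realization_step K \<union> (realization_step K)\<inverse>)\<^sup>*"
  have "sym ?R" by (intro sym_rtrancl sym_Un_converse)
  moreover have "(p, q) \<in> ?R" using assms by (simp add: realization_class_def)
  ultimately have "(p, q) \<in> ?R" "(q, p) \<in> ?R" by (auto dest: symD)
  then show ?thesis unfolding realization_class_def by (auto intro: rtrancl_trans)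
qed

lemma realization_map_class:
  assumes "is_simp_map K L f"
  shows "realization_map L f (realization_class K (n, x, t)) = realization_class L (n, f n x, t)"
proof -
  let ?F = "\<lambda>(n, x, t). (n, f n x, t)"
  let ?K = "realization_step K" and ?L = "realization_step L"
  have F: "(?F p, ?F q) \<in> ?L" if pq: "(p, q) \<in> ?K" for p q
  proof -
    obtain m k \<theta> y s where *: "p = (m, pull K m k \<theta> y, s)" "q = (k, y, simplex_push m \<theta> s)"
      and mem: "\<theta> \<in> ord_maps m k" "y \<in> simps_of K k" "s \<in> standard_simplex m"
      using pq unfolding realization_step_def by blast
    have "f m (pull K m k \<theta> y) = pull L m k \<theta> (f k y)" "f k y \<in> simps_of L k"
      using assms mem unfolding is_simp_map_def by blast+
    with mem show ?thesis unfolding realization_step_def * by auto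
  qed
  have "(?F p, ?F q) \<in> (?L \<union> ?L\<inverse>)\<^sup>*" if "(p, q) \<in> (?K \<union> ?K\<inverse>)\<^sup>*" for p q
    using that
  proof (induction rule: rtrancl_induct)
    case base
    show ?case by (rule rtrancl_refl)
  next
    case (step q r)
    then have "(?F q, ?F r) \<in> ?L \<union> ?L\<inverse>" using F by blast
    with step.IH show ?case by (rule rtrancl_into_rtrancl)
  qed
  note paths = this[of "(n, x, t)"]
  have eq: "realization_class L (?F q) = realization_class L (n, f n x, t)"
    if "q \<in> realization_class K (n, x, t)" for q
    using that paths[of q] by (intro realization_class_eq) (simp add: realization_class_def)
  have "realization_class K (n, x, t) \<noteq> {}" by (auto simp: realization_class_def)
  moreover have "realization_map L f (realization_class K (n, x, t)) =
      (\<Union>q\<in>realization_class K (n, x, t). realization_class L (?F q))"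
    by (simp add: realization_map_def split_def)
  ultimately show ?thesis using eq by blast
qed


subsection \<open>Weak homotopy equivalences\<close>

definition cube :: "nat \<Rightarrow> (nat \<Rightarrow> real) topology" where
  "cube n = product_topology (\<lambda>_. top_of_set {0..1}) {..<n}"

definition cube_boundary :: "nat \<Rightarrow> (nat \<Rightarrow> real) set" where
  "cube_boundary n = {s \<in> topspace (cube n). \<exists>i<n. s i = 0 \<or> s i = 1}"

definition loops :: "nat \<Rightarrow> 'a topology \<Rightarrow> 'a \<Rightarrow> ((nat \<Rightarrow> real) \<Rightarrow> 'a) set" where
  "loops n X x = {h. continuous_map (cube n) X h \<and> (\<forall>s\<in>cube_boundary n. h s = x)}"

definition loop_homotopy ::
    "nat \<Rightarrow> 'a topology \<Rightarrow> 'a \<Rightarrow> ((nat \<Rightarrow> real) \<Rightarrow> 'a) rel" where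
  "loop_homotopy n X x =
     {(h, k). homotopic_with (\<lambda>h. \<forall>s\<in>cube_boundary n. h s = x) (cube n) X h k}"

text \<open>The underlying set of \<open>\<pi>\<^sub>n(X, x)\<close>, for \<open>n \<ge> 1\<close>.\<close>

definition homotopy_group ::
    "nat \<Rightarrow> 'a topology \<Rightarrow> 'a \<Rightarrow> ((nat \<Rightarrow> real) \<Rightarrow> 'a) set set" where
  "homotopy_group n X x = loops n X x // loop_homotopy n X x"

definition homotopy_group_map ::
    "nat \<Rightarrow> 'a topology \<Rightarrow> 'c topology \<Rightarrow> ('a \<Rightarrow> 'c) \<Rightarrow> 'a
      \<Rightarrow> ((nat \<Rightarrow> real) \<Rightarrow> 'a) set \<Rightarrow> ((nat \<Rightarrow> real) \<Rightarrow> 'c) set" where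
  "homotopy_group_map n X Y f x C = (\<Union>h\<in>C. loop_homotopy n Y (f x) `` {f \<circ> h})"

text \<open>The induced maps on homotopy groups are always homomorphisms, so they are isomorphisms
  exactly when they are bijective; the group structure is therefore not needed.\<close>

definition weak_homotopy_equivalence ::
    "'a topology \<Rightarrow> 'c topology \<Rightarrow> ('a \<Rightarrow> 'c) \<Rightarrow> bool" where
  "weak_homotopy_equivalence X Y f \<longleftrightarrow>
     continuous_map X Y f \<and>
     bij_betw (\<lambda>C. \<Union>x\<in>C. path_component_of_set Y (f x))
       (path_components_of X) (path_components_of Y) \<and>
     (\<forall>n\<ge>1. \<forall>x\<in>topspace X.
        bij_betw (homotopy_group_map n X Y f x)
          (homotopy_group n X x) (homotopy_group n Y (f x)))"

definition weak_equivalence ::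
    "('a, 'x) simp_set_scheme \<Rightarrow> ('c, 'y) simp_set_scheme \<Rightarrow> (nat \<Rightarrow> 'a \<Rightarrow> 'c) \<Rightarrow> bool" where
  "weak_equivalence K L f \<longleftrightarrow>
     is_simp_map K L f \<and>
     weak_homotopy_equivalence (realization K) (realization L) (realization_map L f)"


subsection \<open>Simplicial sets with a left group action\<close>

record ('g, 'a) gsimp_set = "'a simp_set" +
  lact :: "nat \<Rightarrow> 'g \<Rightarrow> 'a \<Rightarrow> 'a"

definition is_gsimp_set ::
    "('g, 'b) monoid_scheme \<Rightarrow> ('g, 'a) gsimp_set \<Rightarrow> bool" where
  "is_gsimp_set \<Gamma> K \<longleftrightarrow>
     is_simp_set K \<and>
     (\<forall>\<gamma>\<in>carrier \<Gamma>. is_simp_map K K (\<lambda>n. lact K n \<gamma>)) \<and>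
     (\<forall>n. \<forall>x\<in>simps_of K n. lact K n \<one>\<^bsub>\<Gamma>\<^esub> x = x) \<and>
     (\<forall>\<gamma>\<in>carrier \<Gamma>. \<forall>\<delta>\<in>carrier \<Gamma>. \<forall>n. \<forall>x\<in>simps_of K n.
        lact K n (\<gamma> \<otimes>\<^bsub>\<Gamma>\<^esub> \<delta>) x = lact K n \<gamma> (lact K n \<delta> x))"

definition is_gsimp_map ::
    "('g, 'b) monoid_scheme \<Rightarrow> ('g, 'a) gsimp_set \<Rightarrow> ('g, 'c) gsimp_set
      \<Rightarrow> (nat \<Rightarrow> 'a \<Rightarrow> 'c) \<Rightarrow> bool" where
  "is_gsimp_map \<Gamma> K L f \<longleftrightarrow>
     is_gsimp_set \<Gamma> K \<and> is_gsimp_set \<Gamma> L \<and> is_simp_map K L f \<and>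
     (\<forall>\<gamma>\<in>carrier \<Gamma>. \<forall>n. \<forall>x\<in>simps_of K n. f n (lact K n \<gamma> x) = lact L n \<gamma> (f n x))"

definition fixed_points :: "('g, 'a) gsimp_set \<Rightarrow> 'g set \<Rightarrow> 'a simp_set" where
  "fixed_points K H =
     \<lparr>simps_of = (\<lambda>n. {x \<in> simps_of K n. \<forall>\<gamma>\<in>H. lact K n \<gamma> x = x}), pull = pull K\<rparr>"

definition gweak_equivalence ::
    "('g, 'b) monoid_scheme \<Rightarrow> ('g, 'a) gsimp_set \<Rightarrow> ('g, 'c) gsimp_set
      \<Rightarrow> (nat \<Rightarrow> 'a \<Rightarrow> 'c) \<Rightarrow> bool" where
  "gweak_equivalence \<Gamma> K L f \<longleftrightarrow>
     is_gsimp_map \<Gamma> K L f \<and>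
     (\<forall>H. subgroup H \<Gamma> \<longrightarrow> weak_equivalence (fixed_points K H) (fixed_points L H) f)"


section \<open>The map from \<open>\<Gamma>\<close> to \<open>Sing(T,T)\<close>\<close>

text \<open>The discrete simplicial set: each \<open>K\<^sub>n\<close> is \<open>\<Gamma>\<close>, all structure maps are the identity.\<close>

definition discrete_gsimp_set :: "('g, 'b) monoid_scheme \<Rightarrow> ('g, 'g) gsimp_set" where
  "discrete_gsimp_set \<Gamma> =
     \<lparr>simps_of = (\<lambda>n. carrier \<Gamma>), pull = (\<lambda>m n \<theta> x. x), lact = (\<lambda>n \<gamma> x. \<gamma> \<otimes>\<^bsub>\<Gamma>\<^esub> x)\<rparr>"

definition Sing ::
    "'v ugraph \<Rightarrow> ('v \<Rightarrow> 'g \<Rightarrow> 'v) \<Rightarrow> 'w ugraph \<Rightarrow> ('g, 'v \<times> nat \<Rightarrow> 'w) gsimp_set" where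
  "Sing T ra G =
     \<lparr>simps_of = (\<lambda>n. graph_hom (graph_prod T (Sigma_graph n)) G),
      pull = (\<lambda>m n \<theta> f. \<lambda>(v, i)\<in>gverts T \<times> {..m}. f (v, \<theta> i)),
      lact = (\<lambda>n \<gamma> f. \<lambda>(v, i)\<in>gverts T \<times> {..n}. f (ra v \<gamma>, i))\<rparr>"

text \<open>In degree \<open>n\<close>, the degenerate simplex on the vertex \<open>\<alpha>\<^sub>\<gamma>\<close>: this is the only simplicial map
  sending each vertex \<open>\<gamma>\<close> to \<open>\<alpha>\<^sub>\<gamma>\<close>.\<close>

definition act_simp_map ::
    "'v ugraph \<Rightarrow> ('v \<Rightarrow> 'g \<Rightarrow> 'v) \<Rightarrow> nat \<Rightarrow> 'g \<Rightarrow> ('v \<times> nat \<Rightarrow> 'v)" where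
  "act_simp_map T ra n \<gamma> = (\<lambda>(v, i)\<in>gverts T \<times> {..n}. act_hom T ra \<gamma> v)"

subsection \<open>Well-formedness\<close>

lemma act_hom_in_hom:
  assumes "right_graph_action \<Gamma> T ra"
  shows "act_hom T ra \<in> hom \<Gamma> (Aut T)"
proof (rule homI)
  fix \<gamma> assume "\<gamma> \<in> carrier \<Gamma>"
  then show "act_hom T ra \<gamma> \<in> carrier (Aut T)"
    using assms by (simp add: right_graph_action_def Aut_def)
next
  fix \<gamma> \<delta> assume g: "\<gamma> \<in> carrier \<Gamma>" "\<delta> \<in> carrier \<Gamma>"
  then have "act_hom T ra \<gamma> \<in> gverts T \<rightarrow>\<^sub>E gverts T"
    using assms by (auto simp: right_graph_action_def graph_auts_def graph_hom_def)
  then have "ra v \<gamma> \<in> gverts T" if "v \<in> gverts T" for v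
    using that by (auto simp: act_hom_def)
  then show "act_hom T ra (\<gamma> \<otimes>\<^bsub>\<Gamma>\<^esub> \<delta>) = act_hom T ra \<gamma> \<otimes>\<^bsub>Aut T\<^esub> act_hom T ra \<delta>"
    using assms g by (auto simp: right_graph_action_def Aut_def act_hom_def compose_def)
qed

lemma is_gsimp_set_discrete:
  assumes "group \<Gamma>"
  shows "is_gsimp_set \<Gamma> (discrete_gsimp_set \<Gamma>)"
proof -
  interpret group \<Gamma> by fact
  show ?thesis
    by (auto simp: is_gsimp_set_def is_simp_set_def is_simp_map_def discrete_gsimp_set_def m_assoc)
qed

lemma right_graph_action_closed:
  assumes "right_graph_action \<Gamma> T ra" "\<gamma> \<in> carrier \<Gamma>"
  shows "v \<in> gverts T \<Longrightarrow> ra v \<gamma> \<in> gverts T"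
    and "is_graph T \<Longrightarrow> (u, v) \<in> gedges T \<Longrightarrow> (ra u \<gamma>, ra v \<gamma>) \<in> gedges T"
proof -
  have h: "act_hom T ra \<gamma> \<in> graph_hom T T"
    using assms by (auto simp: right_graph_action_def graph_auts_def)
  show "v \<in> gverts T \<Longrightarrow> ra v \<gamma> \<in> gverts T"
    using h by (auto simp: graph_hom_def act_hom_def)
  assume "is_graph T" and e: "(u, v) \<in> gedges T"
  then have "u \<in> gverts T" "v \<in> gverts T" by (auto simp: is_graph_def)
  then show "(ra u \<gamma>, ra v \<gamma>) \<in> gedges T"
    using h e by (fastforce simp: graph_hom_def act_hom_def)
qed

lemma graph_hom_prod_Sigma_iff:
  "f \<in> graph_hom (graph_prod T (Sigma_graph n)) G \<longleftrightarrow>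
     f \<in> extensional (gverts T \<times> {..n}) \<and>
     (\<forall>v\<in>gverts T. \<forall>i\<le>n. f (v, i) \<in> gverts G) \<and>
     (\<forall>u v i j. (u, v) \<in> gedges T \<longrightarrow> i \<le> n \<longrightarrow> j \<le> n \<longrightarrow> (f (u, i), f (v, j)) \<in> gedges G)"
  by (auto simp: graph_hom_def graph_prod_def Sigma_graph_def PiE_def Pi_def)

lemma ord_maps_le: "\<theta> \<in> ord_maps m n \<Longrightarrow> i \<le> m \<Longrightarrow> \<theta> i \<le> n"
  by (auto simp: ord_maps_def)

lemma is_gsimp_set_Sing:
  assumes "group \<Gamma>" "is_graph T" "right_graph_action \<Gamma> T ra"
  shows "is_gsimp_set \<Gamma> (Sing T ra G)"
proof -
  interpret group \<Gamma> by fact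
  let ?S = "\<lambda>n. graph_hom (graph_prod T (Sigma_graph n)) G"
  have v: "u \<in> gverts T \<and> v \<in> gverts T" if "(u, v) \<in> gedges T" for u v
    using assms(2) that by (auto simp: is_graph_def)
  note cl = right_graph_action_closed[OF assms(3)]
  have one: "ra v \<one>\<^bsub>\<Gamma>\<^esub> = v" if "v \<in> gverts T" for v
    using assms(3) that by (simp add: right_graph_action_def)
  have mul: "ra v (\<gamma> \<otimes>\<^bsub>\<Gamma>\<^esub> \<delta>) = ra (ra v \<gamma>) \<delta>"
    if "v \<in> gverts T" "\<gamma> \<in> carrier \<Gamma>" "\<delta> \<in> carrier \<Gamma>" for v \<gamma> \<delta>
    using assms(3) that by (simp add: right_graph_action_def)
  have pull: "(\<lambda>(v, i)\<in>gverts T \<times> {..m}. f (v, \<theta> i)) \<in> ?S m"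
    if "f \<in> ?S n" "\<theta> \<in> ord_maps m n" for f m n \<theta>
    using that(1) unfolding graph_hom_prod_Sigma_iff by (auto simp: ord_maps_le[OF that(2)] dest: v)
  have lact: "(\<lambda>(v, i)\<in>gverts T \<times> {..n}. f (ra v \<gamma>, i)) \<in> ?S n"
    if "f \<in> ?S n" "\<gamma> \<in> carrier \<Gamma>" for f n \<gamma>
    using that(1) unfolding graph_hom_prod_Sigma_iff
    by (auto simp: cl(1)[OF that(2)] cl(2)[OF that(2) assms(2)] dest: v)
  have ext: "f \<in> extensional (gverts T \<times> {..n})" if "f \<in> ?S n" for f n
    using that by (simp add: graph_hom_prod_Sigma_iff)
  have "is_simp_set (Sing T ra G)"
    unfolding is_simp_set_def Sing_def simp_set.simps gsimp_set.simps
  proof (intro conjI allI ballI)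
    fix n f assume "f \<in> ?S n"
    then show "(\<lambda>(v, i)\<in>gverts T \<times> {..n}. f (v, (\<lambda>i\<in>{..n}. i) i)) = f"
      by (intro extensionalityI[OF _ ext]) auto
  next
    fix l m n \<phi> \<theta> f assume "\<phi> \<in> ord_maps l m"
    then show "(\<lambda>(v, i)\<in>gverts T \<times> {..l}. (\<lambda>(v, i)\<in>gverts T \<times> {..m}. f (v, \<theta> i)) (v, \<phi> i)) =
        (\<lambda>(v, i)\<in>gverts T \<times> {..l}. f (v, compose {..l} \<theta> \<phi> i))"
      by (intro restrict_ext) (auto simp: ord_maps_le compose_def)
  qed (use pull in blast)
  moreover have "is_simp_map (Sing T ra G) (Sing T ra G) (\<lambda>n. lact (Sing T ra G) n \<gamma>)"
    if g: "\<gamma> \<in> carrier \<Gamma>" for \<gamma>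
    unfolding is_simp_map_def Sing_def simp_set.simps gsimp_set.simps
  proof (intro conjI allI ballI)
    fix m n \<theta> f assume "\<theta> \<in> ord_maps m n"
    then show "(\<lambda>(v, i)\<in>gverts T \<times> {..m}. (\<lambda>(v, i)\<in>gverts T \<times> {..m}. f (v, \<theta> i)) (ra v \<gamma>, i)) =
        (\<lambda>(v, i)\<in>gverts T \<times> {..m}. (\<lambda>(v, i)\<in>gverts T \<times> {..n}. f (ra v \<gamma>, i)) (v, \<theta> i))"
      by (intro restrict_ext) (auto simp: ord_maps_le cl(1)[OF g])
  qed (use lact[OF _ g] in blast)
  moreover have "lact (Sing T ra G) n \<one>\<^bsub>\<Gamma>\<^esub> f = f" if "f \<in> simps_of (Sing T ra G) n" for n f
    using that unfolding Sing_def simp_set.simps gsimp_set.simps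
    by (intro extensionalityI[OF _ ext]) (auto simp: one)
  moreover have "lact (Sing T ra G) n (\<gamma> \<otimes>\<^bsub>\<Gamma>\<^esub> \<delta>) f = lact (Sing T ra G) n \<gamma> (lact (Sing T ra G) n \<delta> f)"
    if "\<gamma> \<in> carrier \<Gamma>" "\<delta> \<in> carrier \<Gamma>" for n \<gamma> \<delta> f
    unfolding Sing_def gsimp_set.simps
    by (intro restrict_ext) (auto simp: mul that cl(1)[OF that(1)])
  ultimately show ?thesis
    unfolding is_gsimp_set_def by blast
qed

lemma is_gsimp_map_act_simp_map:
  assumes "group \<Gamma>" "is_graph T" "right_graph_action \<Gamma> T ra"
  shows "is_gsimp_map \<Gamma> (discrete_gsimp_set \<Gamma>) (Sing T ra T) (act_simp_map T ra)"
proof -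
  have v: "u \<in> gverts T \<and> v \<in> gverts T" if "(u, v) \<in> gedges T" for u v
    using assms(2) that by (auto simp: is_graph_def)
  note cl = right_graph_action_closed[OF assms(3)]
  have mul: "ra v (\<gamma> \<otimes>\<^bsub>\<Gamma>\<^esub> \<delta>) = ra (ra v \<gamma>) \<delta>"
    if "v \<in> gverts T" "\<gamma> \<in> carrier \<Gamma>" "\<delta> \<in> carrier \<Gamma>" for v \<gamma> \<delta>
    using assms(3) that by (simp add: right_graph_action_def)
  have "act_simp_map T ra n \<gamma> \<in> graph_hom (graph_prod T (Sigma_graph n)) T"
    if "\<gamma> \<in> carrier \<Gamma>" for n \<gamma>
    unfolding graph_hom_prod_Sigma_iff act_simp_map_def act_hom_def
    by (auto simp: cl(1)[OF that] cl(2)[OF that assms(2)] dest: v)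
  moreover have "act_simp_map T ra m \<gamma> = pull (Sing T ra T) m n \<theta> (act_simp_map T ra n \<gamma>)"
    if "\<theta> \<in> ord_maps m n" for m n \<theta> \<gamma>
    unfolding act_simp_map_def Sing_def simp_set.simps
    by (intro restrict_ext) (auto simp: ord_maps_le[OF that])
  moreover have "act_simp_map T ra n (\<gamma> \<otimes>\<^bsub>\<Gamma>\<^esub> \<delta>) = lact (Sing T ra T) n \<gamma> (act_simp_map T ra n \<delta>)"
    if "\<gamma> \<in> carrier \<Gamma>" "\<delta> \<in> carrier \<Gamma>" for n \<gamma> \<delta>
    unfolding act_simp_map_def Sing_def gsimp_set.simps act_hom_def
    by (intro restrict_ext) (auto simp: mul that cl(1)[OF that(1)])
  ultimately show ?thesis
    using is_gsimp_set_Sing[OF assms] is_gsimp_set_discrete[OF assms(1)]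
    by (simp add: is_gsimp_map_def is_simp_map_def discrete_gsimp_set_def Sing_def)
qed

end

theory Submission
  imports Defs
begin

text \<open>The key is a rigidity phenomenon: in \<open>Sing(T,T)\<close> for a stiff graph \<open>T\<close>, an automorphism is an
  isolated point. If one vertex of a simplex \<open>F : T \<times> \<Sigma>\<^sup>n \<rightarrow> T\<close> is an automorphism \<open>a\<close>, then every
  neighbour of \<open>a v\<close> is also a neighbour of \<open>F (v, i)\<close>, and stiffness gives \<open>F (v, i) = a v\<close>, so that
  \<open>F\<close> is the degenerate simplex on \<open>a\<close> (\<open>stiff_simplex_at_aut_const\<close>).

  Suppose that \<open>\<alpha>\<close> is an isomorphism onto \<open>Aut(T)\<close> and that every endomorphism is an automorphism.
  By rigidity every simplex of \<open>Sing(T,T)\<close> is then degenerate on a unique \<open>\<alpha>\<^sub>\<gamma>\<close>, so the comparison map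
  is an isomorphism of \<open>\<Gamma>\<close>-simplicial sets. Such a map restricts to isomorphisms on all fixed points,
  and these realize to homeomorphisms (\<open>levelwise_bij_imp_gweak_equivalence\<close>).

  Conversely, a \<open>\<Gamma>\<close>-weak equivalence is bijective on path components at the trivial subgroup. The
  discrete simplicial set has one component for each element of \<open>\<Gamma>\<close>, and by rigidity the component
  of \<open>\<alpha>\<^sub>\<gamma>\<close> contains no other endomorphism. Surjectivity therefore makes every endomorphism equal to
  some \<open>\<alpha>\<^sub>\<gamma>\<close>, in particular an automorphism, and injectivity makes \<open>\<alpha>\<close> injective. Both computations of
  components rest on \<open>path_component_realization_invariant\<close>: a property of simplices preserved and
  reflected by the structure maps is constant along paths in the realization.\<close>

section \<open>Components of a geometric realization\<close>

lemma continuous_map_from_sum_topology: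
  assumes "\<And>i. i \<in> I \<Longrightarrow> continuous_map (X i) Z (\<lambda>x. h (i, x))"
  shows "continuous_map (sum_topology X I) Z h"
proof -
  have "openin (X i) {x. (i, x) \<in> {p \<in> Sigma I (topspace \<circ> X). h p \<in> U}}"
    if "openin Z U" "i \<in> I" for U i
    using openin_continuous_map_preimage[OF assms that(1)] that(2) by simp
  moreover have "h p \<in> topspace Z" if "p \<in> Sigma I (topspace \<circ> X)" for p
    using that assms by (auto simp: continuous_map_def Pi_iff)
  ultimately show ?thesis
    by (auto simp: continuous_map_def openin_sum_topology)
qed

lemma topspace_pre_realization:
  "topspace (pre_realization K) = (SIGMA n:UNIV. simps_of K n \<times> standard_simplex n)"
  by (auto simp: pre_realization_def topspace_standard_simplex)

lemma topspace_realization: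
  "topspace (realization K) = realization_class K ` topspace (pre_realization K)"
  using quotient_map_realization by (metis quotient_imp_surjective_map)

lemma realization_class_in_topspace:
  assumes "x \<in> simps_of K n" "t \<in> standard_simplex n"
  shows "realization_class K (n, x, t) \<in> topspace (realization K)"
  using assms by (auto simp: topspace_realization topspace_pre_realization)

lemma realization_point_cases:
  assumes "p \<in> topspace (realization K)"
  obtains n x t where "p = realization_class K (n, x, t)"
    "x \<in> simps_of K n" "t \<in> standard_simplex n"
  using assms by (auto simp: topspace_realization topspace_pre_realization)

text \<open>A function on simplices that is compatible with all structure maps factors through the
  generating relation of the realization, and on each cell it is constant. It therefore descends
  to a continuous map into a discrete space, and such a map cannot vary along a path.\<close>

lemma path_component_realization_invariant:
  fixes c :: "nat \<Rightarrow> 'a \<Rightarrow> 'c"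
  assumes inv: "\<And>m n \<theta> x. \<theta> \<in> ord_maps m n \<Longrightarrow> x \<in> simps_of K n \<Longrightarrow> c m (pull K m n \<theta> x) = c n x"
    and path: "path_component_of (realization K)
      (realization_class K (n, x, t)) (realization_class K (n', x', t'))"
    and mem: "x \<in> simps_of K n" "t \<in> standard_simplex n"
      "x' \<in> simps_of K n'" "t' \<in> standard_simplex n'"
  shows "c n x = c n' x'"
proof -
  let ?h = "\<lambda>(n, x, t :: nat \<Rightarrow> real). c n x"
  let ?R = "realization_step K \<union> (realization_step K)\<inverse>"
  have step: "?h p = ?h q" if "(p, q) \<in> realization_step K" for p q
    using that inv unfolding realization_step_def by auto
  have rel: "?h p = ?h q" if "(p, q) \<in> ?R\<^sup>*" for p q
    using that by (induction rule: rtrancl_induct) (use step in fastforce)+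
  have cong: "?h p = ?h q" if "realization_class K p = realization_class K q" for p q
  proof -
    have "q \<in> realization_class K p"
      unfolding that by (simp add: realization_class_def)
    then show ?thesis
      by (intro rel) (simp add: realization_class_def)
  qed
  have "continuous_map (pre_realization K) (discrete_topology UNIV) ?h"
    unfolding pre_realization_def
  proof (rule continuous_map_from_sum_topology)
    fix n
    show "continuous_map (prod_topology (discrete_topology (simps_of K n))
        (subtopology (powertop_real UNIV) (standard_simplex n)))
      (discrete_topology UNIV) (\<lambda>q. ?h (n, q))"
      using continuous_map_compose[OF continuous_map_fst, of "discrete_topology (simps_of K n)"
          "discrete_topology UNIV" "c n"]
      by (simp add: o_def split_def)
  qed
  then obtain g where g: "continuous_map (realization K) (discrete_topology UNIV) g"
    and gh: "\<And>p. p \<in> topspace (pre_realization K) \<Longrightarrow> g (realization_class K p) = ?h p"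
    using quotient_map_lift_exists[OF quotient_map_realization, of K "discrete_topology UNIV" ?h] cong
    by metis
  from path_component_of_continuous_image[OF g path]
  have "g (realization_class K (n, x, t)) = g (realization_class K (n', x', t'))"
    by simp
  then show ?thesis
    using gh mem by (simp add: topspace_pre_realization)
qed

lemma continuous_map_realization_map:
  assumes f: "is_simp_map K L f"
  shows "continuous_map (realization K) (realization L) (realization_map L f)"
proof -
  have "continuous_map (pre_realization K) (pre_realization L) (\<lambda>(n, x, t). (n, f n x, t))"
    unfolding pre_realization_def
  proof (rule continuous_map_from_sum_topology)
    fix n
    let ?\<Delta> = "subtopology (powertop_real UNIV) (standard_simplex n)"
    let ?XK = "prod_topology (discrete_topology (simps_of K n)) ?\<Delta>"
    let ?XL = "\<lambda>n. prod_topology (discrete_topology (simps_of L n))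
      (subtopology (powertop_real UNIV) (standard_simplex n))"
    have "continuous_map (discrete_topology (simps_of K n)) (discrete_topology (simps_of L n)) (f n)"
      using f by (auto simp: is_simp_map_def)
    then have "continuous_map ?XK (discrete_topology (simps_of L n)) (\<lambda>q. f n (fst q))"
      using continuous_map_compose[OF continuous_map_fst] by (simp only: o_def)
    then have "continuous_map ?XK (?XL n) (\<lambda>q. (f n (fst q), snd q))"
      by (rule continuous_map_pairedI[OF _ continuous_map_snd])
    from continuous_map_compose[OF this continuous_map_component_injection[of n UNIV ?XL]]
    show "continuous_map ?XK (sum_topology ?XL UNIV) (\<lambda>q. case (n, q) of (n, x, t) \<Rightarrow> (n, f n x, t))"
      by (simp add: o_def split_def)
  qed
  then have "continuous_map (pre_realization K) (realization L)
      (realization_class L \<circ> (\<lambda>(n, x, t). (n, f n x, t)))"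
    using quotient_imp_continuous_map[OF quotient_map_realization] by (rule continuous_map_compose)
  also have "realization_class L \<circ> (\<lambda>(n, x, t). (n, f n x, t)) =
      realization_map L f \<circ> realization_class K"
    by (simp add: fun_eq_iff realization_map_class[OF f])
  finally show ?thesis
    by (rule continuous_compose_quotient_map[OF quotient_map_realization])
qed

text \<open>This evaluates the induced map on path components at the component of a given point.\<close>

lemma Union_path_component_of_image:
  assumes "continuous_map X Y f" "x \<in> topspace X"
  shows "(\<Union>y\<in>path_component_of_set X x. path_component_of_set Y (f y)) =
    path_component_of_set Y (f x)"
proof
  show "(\<Union>y\<in>path_component_of_set X x. path_component_of_set Y (f y)) \<subseteq> path_component_of_set Y (f x)"
    using path_component_of_continuous_image[OF assms(1)] by (auto intro: path_component_of_trans)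
  have "x \<in> path_component_of_set X x"
    using assms(2) by (simp add: path_component_of_refl)
  then show "path_component_of_set Y (f x) \<subseteq>
      (\<Union>y\<in>path_component_of_set X x. path_component_of_set Y (f y))"
    by blast
qed

section \<open>Isomorphisms are weak equivalences\<close>

lemma path_components_bij_homeomorphic_maps:
  assumes "homeomorphic_maps X Y f g"
  shows "bij_betw (\<lambda>C. \<Union>x\<in>C. path_component_of_set Y (f x))
    (path_components_of X) (path_components_of Y)"
proof -
  let ?F = "\<lambda>C. \<Union>x\<in>C. path_component_of_set Y (f x)"
  let ?G = "\<lambda>D. \<Union>y\<in>D. path_component_of_set X (g y)"
  have f: "continuous_map X Y f" and g: "continuous_map Y X g"
    and gf: "\<And>x. x \<in> topspace X \<Longrightarrow> g (f x) = x" and fg: "\<And>y. y \<in> topspace Y \<Longrightarrow> f (g y) = y"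
    using assms by (auto simp: homeomorphic_maps_def)
  have fX: "f x \<in> topspace Y" if "x \<in> topspace X" for x
    using f that by (auto simp: continuous_map_def)
  have gY: "g y \<in> topspace X" if "y \<in> topspace Y" for y
    using g that by (auto simp: continuous_map_def)
  have F: "?F (path_component_of_set X x) = path_component_of_set Y (f x)" if "x \<in> topspace X" for x
    by (rule Union_path_component_of_image[OF f that])
  have G: "?G (path_component_of_set Y y) = path_component_of_set X (g y)" if "y \<in> topspace Y" for y
    by (rule Union_path_component_of_image[OF g that])
  show ?thesis
    unfolding path_components_of_def
  proof (rule bij_betw_byWitness[where f' = ?G]; (rule ballI subsetI; elim imageE; hypsubst)?)
    fix x assume x: "x \<in> topspace X"
    show "?G (?F (path_component_of_set X x)) = path_component_of_set X x"
      by (simp only: F[OF x] G[OF fX[OF x]] gf[OF x])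
    show "?F (path_component_of_set X x) \<in> path_component_of_set Y ` topspace Y"
      unfolding F[OF x] by (rule imageI[OF fX[OF x]])
  next
    fix y assume y: "y \<in> topspace Y"
    show "?F (?G (path_component_of_set Y y)) = path_component_of_set Y y"
      by (simp only: G[OF y] F[OF gY[OF y]] fg[OF y])
    show "?G (path_component_of_set Y y) \<in> path_component_of_set X ` topspace X"
      unfolding G[OF y] by (rule imageI[OF gY[OF y]])
  qed
qed

lemma equiv_loop_homotopy: "equiv (loops n X x) (loop_homotopy n X x)"
proof (rule equivI)
  show "loop_homotopy n X x \<subseteq> loops n X x \<times> loops n X x"
    by (auto simp: loop_homotopy_def loops_def
        dest: homotopic_with_imp_continuous_maps homotopic_with_imp_property)
  show "refl_on (loops n X x) (loop_homotopy n X x)"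
    by (auto simp: refl_on_def loop_homotopy_def loops_def)
  show "sym (loop_homotopy n X x)"
    by (auto simp: sym_def loop_homotopy_def intro: homotopic_with_symD)
  show "trans (loop_homotopy n X x)"
    by (auto simp: trans_def loop_homotopy_def intro: homotopic_with_trans)
qed

lemma comp_loop:
  assumes "continuous_map X Y f" "h \<in> loops n X x"
  shows "f \<circ> h \<in> loops n Y (f x)"
  using assms by (auto simp: loops_def intro: continuous_map_compose)

text \<open>The induced map is defined as a union over all representatives of a class; any single one may be
  used to compute it.\<close>

lemma homotopy_group_map_class:
  assumes f: "continuous_map X Y f" and h: "h \<in> loops n X x"
  shows "homotopy_group_map n X Y f x (loop_homotopy n X x `` {h}) =
    loop_homotopy n Y (f x) `` {f \<circ> h}"
proof -
  have "(f \<circ> h, f \<circ> k) \<in> loop_homotopy n Y (f x)" if "(h, k) \<in> loop_homotopy n X x" for k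
    using that unfolding loop_homotopy_def
    by (auto intro!: homotopic_with_compose_continuous_map_left[OF _ f])
  then have "loop_homotopy n Y (f x) `` {f \<circ> k} = loop_homotopy n Y (f x) `` {f \<circ> h}"
    if "(h, k) \<in> loop_homotopy n X x" for k
    using equiv_class_eq[OF equiv_loop_homotopy] that by metis
  moreover have "(h, h) \<in> loop_homotopy n X x"
    using equiv_class_self[OF equiv_loop_homotopy h] by blast
  ultimately show ?thesis
    unfolding homotopy_group_map_def by blast
qed

text \<open>Loops are not extensional: a composite of mutually inverse maps returns a loop that agrees
  with the original one on the cube only. It is still homotopic to it, by a constant homotopy.\<close>

lemma homotopy_group_map_inverse:
  assumes f: "continuous_map X Y f" and g: "continuous_map Y X g"
    and gf: "\<And>x. x \<in> topspace X \<Longrightarrow> g (f x) = x"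
    and x: "x \<in> topspace X" and C: "C \<in> homotopy_group n X x"
  shows "homotopy_group_map n X Y f x C \<in> homotopy_group n Y (f x)"
    and "homotopy_group_map n Y X g (f x) (homotopy_group_map n X Y f x C) = C"
proof -
  obtain h where h: "h \<in> loops n X x" and Ch: "C = loop_homotopy n X x `` {h}"
    using C by (auto simp: homotopy_group_def elim: quotientE)
  have fh: "f \<circ> h \<in> loops n Y (f x)"
    by (rule comp_loop[OF f h])
  have "homotopy_group_map n X Y f x C = loop_homotopy n Y (f x) `` {f \<circ> h}"
    unfolding Ch by (rule homotopy_group_map_class[OF f h])
  then show "homotopy_group_map n X Y f x C \<in> homotopy_group n Y (f x)"
    using fh by (auto simp: homotopy_group_def intro: quotientI)
  have gfh: "g \<circ> (f \<circ> h) \<in> loops n X x"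
    using comp_loop[OF g fh] gf[OF x] by simp
  have hX: "h s \<in> topspace X" if "s \<in> topspace (cube n)" for s
    using h that by (auto simp: loops_def continuous_map_def)
  have "homotopic_with (\<lambda>h. \<forall>s\<in>cube_boundary n. h s = x) (cube n) X h (g \<circ> (f \<circ> h))"
    using h gfh hX gf by (intro homotopic_with_equal) (auto simp: loops_def)
  then have "(h, g \<circ> (f \<circ> h)) \<in> loop_homotopy n X x"
    by (simp add: loop_homotopy_def)
  then have "loop_homotopy n X x `` {g \<circ> (f \<circ> h)} = C"
    unfolding Ch by (metis equiv_class_eq[OF equiv_loop_homotopy])
  then show "homotopy_group_map n Y X g (f x) (homotopy_group_map n X Y f x C) = C"
    using homotopy_group_map_class[OF f h] homotopy_group_map_class[OF g fh] gf[OF x]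
    by (simp add: Ch)
qed

lemma homeomorphic_maps_imp_weak_homotopy_equivalence:
  assumes fg: "homeomorphic_maps X Y f g"
  shows "weak_homotopy_equivalence X Y f"
  unfolding weak_homotopy_equivalence_def
proof (intro conjI allI impI ballI)
  have f: "continuous_map X Y f" and g: "continuous_map Y X g"
    and gf: "\<And>x. x \<in> topspace X \<Longrightarrow> g (f x) = x" and fg': "\<And>y. y \<in> topspace Y \<Longrightarrow> f (g y) = y"
    using fg by (auto simp: homeomorphic_maps_def)
  show "continuous_map X Y f" by (rule f)
  show "bij_betw (\<lambda>C. \<Union>x\<in>C. path_component_of_set Y (f x))
    (path_components_of X) (path_components_of Y)"
    using fg by (rule path_components_bij_homeomorphic_maps)
  fix n x assume x: "x \<in> topspace X"
  then have fx: "f x \<in> topspace Y"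
    using f by (auto simp: continuous_map_def)
  note forward = homotopy_group_map_inverse[OF f g gf x]
  note backward = homotopy_group_map_inverse[OF g f fg' fx, unfolded gf[OF x]]
  show "bij_betw (homotopy_group_map n X Y f x) (homotopy_group n X x) (homotopy_group n Y (f x))"
    by (rule bij_betw_byWitness[where f' = "homotopy_group_map n Y X g (f x)"])
      (use forward backward in auto)
qed

lemma is_simp_map_inv_into:
  assumes K: "is_simp_set K" and f: "is_simp_map K L f"
    and bij: "\<And>n. bij_betw (f n) (simps_of K n) (simps_of L n)"
  shows "is_simp_map L K (\<lambda>n. inv_into (simps_of K n) (f n))"
  unfolding is_simp_map_def
proof (intro conjI allI ballI)
  let ?g = "\<lambda>n. inv_into (simps_of K n) (f n)"
  show g: "?g n y \<in> simps_of K n" if "y \<in> simps_of L n" for n y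
    using bij_betw_apply[OF bij_betw_inv_into[OF bij] that] .
  fix m n \<theta> y assume \<theta>: "\<theta> \<in> ord_maps m n" and y: "y \<in> simps_of L n"
  have "f m (pull K m n \<theta> (?g n y)) = pull L m n \<theta> y"
    using f \<theta> g[OF y] bij_betw_inv_into_right[OF bij y] by (simp add: is_simp_map_def)
  moreover have "pull K m n \<theta> (?g n y) \<in> simps_of K m"
    using K \<theta> g[OF y] by (simp add: is_simp_set_def)
  ultimately show "?g m (pull L m n \<theta> y) = pull K m n \<theta> (?g n y)"
    using bij_betw_inv_into_left[OF bij] by metis
qed

lemma levelwise_bij_imp_weak_equivalence:
  assumes K: "is_simp_set K" and f: "is_simp_map K L f"
    and bij: "\<And>n. bij_betw (f n) (simps_of K n) (simps_of L n)"
  shows "weak_equivalence K L f"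
proof -
  let ?g = "\<lambda>n. inv_into (simps_of K n) (f n)"
  have g: "is_simp_map L K ?g"
    by (rule is_simp_map_inv_into[OF assms])
  have "realization_map K ?g (realization_map L f p) = p" if "p \<in> topspace (realization K)" for p
    using that bij_betw_inv_into_left[OF bij]
    by (elim realization_point_cases) (simp add: realization_map_class[OF f] realization_map_class[OF g])
  moreover have "realization_map L f (realization_map K ?g p) = p" if "p \<in> topspace (realization L)" for p
    using that bij_betw_inv_into_right[OF bij]
    by (elim realization_point_cases) (simp add: realization_map_class[OF f] realization_map_class[OF g])
  ultimately have "homeomorphic_maps (realization K) (realization L)
      (realization_map L f) (realization_map K ?g)"
    using continuous_map_realization_map[OF f] continuous_map_realization_map[OF g]
    by (simp add: homeomorphic_maps_def)
  then show ?thesis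
    using f homeomorphic_maps_imp_weak_homotopy_equivalence by (auto simp: weak_equivalence_def)
qed

lemma is_simp_set_fixed_points:
  assumes K: "is_gsimp_set \<Gamma> K" and H: "H \<subseteq> carrier \<Gamma>"
  shows "is_simp_set (fixed_points K H)"
proof -
  have "is_simp_map K K (\<lambda>n. lact K n \<gamma>)" if "\<gamma> \<in> H" for \<gamma>
    using K H that by (auto simp: is_gsimp_set_def)
  then have "lact K m \<gamma> (pull K m n \<theta> x) = pull K m n \<theta> (lact K n \<gamma> x)"
    if "\<gamma> \<in> H" "\<theta> \<in> ord_maps m n" "x \<in> simps_of K n" for \<gamma> m n \<theta> x
    using that by (simp add: is_simp_map_def)
  moreover have "is_simp_set K"
    using K by (simp add: is_gsimp_set_def)
  ultimately show ?thesis
    by (simp add: is_simp_set_def fixed_points_def)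
qed

lemma is_simp_map_fixed_points:
  assumes "is_gsimp_map \<Gamma> K L f" "H \<subseteq> carrier \<Gamma>"
  shows "is_simp_map (fixed_points K H) (fixed_points L H) f"
proof -
  have "lact L n \<gamma> (f n x) = f n (lact K n \<gamma> x)" if "\<gamma> \<in> H" "x \<in> simps_of K n" for n \<gamma> x
    using assms that by (auto simp: is_gsimp_map_def)
  moreover have "is_simp_map K L f"
    using assms(1) by (simp add: is_gsimp_map_def)
  ultimately show ?thesis
    by (simp add: is_simp_map_def fixed_points_def)
qed

text \<open>An equivariant bijection carries the fixed points of every subgroup bijectively onto the fixed
  points of the same subgroup, so the comparison on fixed points is again an isomorphism.\<close>

lemma levelwise_bij_imp_gweak_equivalence:
  assumes f: "is_gsimp_map \<Gamma> K L f"
    and bij: "\<And>n. bij_betw (f n) (simps_of K n) (simps_of L n)"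
  shows "gweak_equivalence \<Gamma> K L f"
  unfolding gweak_equivalence_def
proof (intro conjI allI impI f)
  fix H assume "subgroup H \<Gamma>"
  then have H: "H \<subseteq> carrier \<Gamma>" by (rule subgroup.subset)
  have K: "is_gsimp_set \<Gamma> K" using f by (simp add: is_gsimp_map_def)
  have eq: "lact L n \<gamma> (f n x) = f n (lact K n \<gamma> x)" if "\<gamma> \<in> H" "x \<in> simps_of K n" for n \<gamma> x
    using f H that by (auto simp: is_gsimp_map_def)
  have act: "lact K n \<gamma> x \<in> simps_of K n" if "\<gamma> \<in> H" "x \<in> simps_of K n" for n \<gamma> x
  proof -
    have "is_simp_map K K (\<lambda>n. lact K n \<gamma>)"
      using K H that(1) by (auto simp: is_gsimp_set_def)
    then show ?thesis using that(2) by (simp add: is_simp_map_def)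
  qed
  show "weak_equivalence (fixed_points K H) (fixed_points L H) f"
  proof (rule levelwise_bij_imp_weak_equivalence)
    show "is_simp_set (fixed_points K H)" by (rule is_simp_set_fixed_points[OF K H])
    show "is_simp_map (fixed_points K H) (fixed_points L H) f"
      by (rule is_simp_map_fixed_points[OF f H])
    fix n
    have inj: "inj_on (f n) (simps_of K n)" and im: "f n ` simps_of K n = simps_of L n"
      using bij by (auto simp: bij_betw_def)
    have "lact L n \<gamma> (f n x) = f n x \<longleftrightarrow> lact K n \<gamma> x = x"
      if "\<gamma> \<in> H" "x \<in> simps_of K n" for \<gamma> x
      using eq[OF that] inj_on_eq_iff[OF inj act[OF that] that(2)] by simp
    then have "f n ` simps_of (fixed_points K H) n = simps_of (fixed_points L H) n"
      by (auto simp: fixed_points_def im[symmetric])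
    moreover have "inj_on (f n) (simps_of (fixed_points K H) n)"
      using inj by (rule inj_on_subset) (auto simp: fixed_points_def)
    ultimately show "bij_betw (f n) (simps_of (fixed_points K H) n) (simps_of (fixed_points L H) n)"
      by (simp add: bij_betw_def)
  qed
qed

section \<open>Rigidity of automorphisms of a stiff graph\<close>

text \<open>The iterated degeneracy of the \<open>0\<close>-simplex \<open>a\<close>.\<close>

definition const_simplex :: "'v ugraph \<Rightarrow> nat \<Rightarrow> ('v \<Rightarrow> 'w) \<Rightarrow> 'v \<times> nat \<Rightarrow> 'w" where
  "const_simplex T n a = (\<lambda>(v, i)\<in>gverts T \<times> {..n}. a v)"

definition simplex_vertex :: "'v ugraph \<Rightarrow> ('v \<times> nat \<Rightarrow> 'w) \<Rightarrow> nat \<Rightarrow> 'v \<Rightarrow> 'w" where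
  "simplex_vertex T F i = (\<lambda>v\<in>gverts T. F (v, i))"

lemma const_simplex_in_Sing:
  assumes "is_graph T" "a \<in> graph_hom T G"
  shows "const_simplex T n a \<in> graph_hom (graph_prod T (Sigma_graph n)) G"
proof -
  have "u \<in> gverts T \<and> v \<in> gverts T" if "(u, v) \<in> gedges T" for u v
    using assms(1) that by (auto simp: is_graph_def)
  then show ?thesis
    using assms(2) unfolding graph_hom_prod_Sigma_iff const_simplex_def by (auto simp: graph_hom_def)
qed

lemma simplex_vertex_hom:
  assumes "is_graph T" "F \<in> graph_hom (graph_prod T (Sigma_graph n)) G" "i \<le> n"
  shows "simplex_vertex T F i \<in> graph_hom T G"
proof -
  have "u \<in> gverts T \<and> v \<in> gverts T" if "(u, v) \<in> gedges T" for u v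
    using assms(1) that by (auto simp: is_graph_def)
  then show ?thesis
    using assms(2,3) unfolding graph_hom_prod_Sigma_iff by (auto simp: simplex_vertex_def graph_hom_def)
qed

lemma simplex_vertex_const_simplex:
  "a \<in> graph_hom T G \<Longrightarrow> i \<le> n \<Longrightarrow> simplex_vertex T (const_simplex T n a) i = a"
  by (rule extensionalityI[of _ "gverts T"])
    (auto simp: simplex_vertex_def const_simplex_def graph_hom_def PiE_def)

lemma graph_aut_nbhd:
  assumes T: "is_graph T" and a: "a \<in> graph_auts T" and v: "v \<in> gverts T"
  shows "nbhd T (a v) = a ` nbhd T v"
proof -
  obtain b where b: "b \<in> graph_hom T T"
    and ba: "compose (gverts T) b a = (\<lambda>v\<in>gverts T. v)"
    and ab: "compose (gverts T) a b = (\<lambda>v\<in>gverts T. v)"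
    using a by (auto simp: graph_auts_def)
  have a': "a \<in> graph_hom T T" using a by (simp add: graph_auts_def)
  have ba': "b (a u) = u" if "u \<in> gverts T" for u
    using fun_cong[OF ba, of u] that by (simp add: compose_eq)
  have ab': "a (b u) = u" if "u \<in> gverts T" for u
    using fun_cong[OF ab, of u] that by (simp add: compose_eq)
  show ?thesis
  proof
    show "a ` nbhd T v \<subseteq> nbhd T (a v)"
      using a' by (auto simp: nbhd_def graph_hom_def)
    show "nbhd T (a v) \<subseteq> a ` nbhd T v"
    proof
      fix w assume w: "w \<in> nbhd T (a v)"
      then have wT: "w \<in> gverts T" and e: "(a v, w) \<in> gedges T" by (auto simp: nbhd_def)
      have "(b (a v), b w) \<in> gedges T"
        using b e by (auto simp: graph_hom_def)
      moreover have "b w \<in> gverts T"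
        using b wT by (auto simp: graph_hom_def)
      ultimately have "b w \<in> nbhd T v"
        using v by (simp add: nbhd_def ba')
      then show "w \<in> a ` nbhd T v"
        using ab'[OF wT] by (metis imageI)
    qed
  qed
qed

text \<open>All vertices of a simplex of the mapping complex are mutually compatible: an edge \<open>(u, v)\<close> of
  \<open>T\<close> yields an edge from \<open>F (u, i)\<close> to \<open>F (v, j)\<close> whatever \<open>i\<close> and \<open>j\<close> are. If the \<open>j\<close>-th vertex
  \<open>a\<close> is an automorphism, then \<open>a\<close> maps the neighbours of \<open>v\<close> onto those of \<open>a v\<close>, so every
  neighbour of \<open>a v\<close> is a neighbour of \<open>F (v, i)\<close>. Stiffness leaves no room but \<open>F (v, i) = a v\<close>.\<close>

lemma stiff_simplex_at_aut_const:
  assumes T: "is_graph T" and stiff: "stiff T"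
    and F: "F \<in> graph_hom (graph_prod T (Sigma_graph n)) T"
    and j: "j \<le> n" and aut: "simplex_vertex T F j \<in> graph_auts T"
  shows "F = const_simplex T n (simplex_vertex T F j)"
proof (rule extensionalityI[of _ "gverts T \<times> {..n}"])
  let ?a = "simplex_vertex T F j"
  show "F \<in> extensional (gverts T \<times> {..n})"
    using F by (simp add: graph_hom_prod_Sigma_iff)
  show "const_simplex T n ?a \<in> extensional (gverts T \<times> {..n})"
    by (simp add: const_simplex_def)
  fix p assume "p \<in> gverts T \<times> {..n}"
  then obtain v i where p: "p = (v, i)" and v: "v \<in> gverts T" and i: "i \<le> n" by auto
  have FT: "F (u, k) \<in> gverts T" if "u \<in> gverts T" "k \<le> n" for u k
    using F that by (simp add: graph_hom_prod_Sigma_iff)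
  have "nbhd T (?a v) \<subseteq> nbhd T (F (v, i))"
    unfolding graph_aut_nbhd[OF T aut v]
  proof (rule image_subsetI)
    fix u assume "u \<in> nbhd T v"
    then have "u \<in> gverts T" "(v, u) \<in> gedges T" by (auto simp: nbhd_def)
    then show "?a u \<in> nbhd T (F (v, i))"
      using F i j FT by (simp add: nbhd_def simplex_vertex_def graph_hom_prod_Sigma_iff)
  qed
  moreover have "?a v \<in> gverts T"
    using v j FT by (simp add: simplex_vertex_def)
  ultimately have "F (v, i) = ?a v"
    using stiff FT[OF v i] by (auto simp: stiff_def dismantlable_def)
  then show "F p = const_simplex T n ?a p"
    using v i by (simp add: p const_simplex_def)
qed

lemma pull_Sing_const_simplex:
  assumes "\<theta> \<in> ord_maps m n"
  shows "pull (Sing T ra G) m n \<theta> (const_simplex T n a) = const_simplex T m a"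
  unfolding Sing_def simp_set.simps const_simplex_def
  by (rule restrict_ext) (auto simp: ord_maps_le[OF assms])

lemma stiff_pull_Sing_eq_const_iff:
  assumes T: "is_graph T" and stiff: "stiff T" and a: "a \<in> graph_auts T"
    and \<theta>: "\<theta> \<in> ord_maps m n" and F: "F \<in> graph_hom (graph_prod T (Sigma_graph n)) T"
  shows "pull (Sing T ra T) m n \<theta> F = const_simplex T m a \<longleftrightarrow> F = const_simplex T n a"
proof
  assume eq: "pull (Sing T ra T) m n \<theta> F = const_simplex T m a"
  \<comment> \<open>Every structure map retains a vertex of \<open>F\<close>, and an automorphism as vertex determines \<open>F\<close>.\<close>
  have "simplex_vertex T F (\<theta> 0) = simplex_vertex T (pull (Sing T ra T) m n \<theta> F) 0"
    by (auto simp: simplex_vertex_def Sing_def)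
  also have "\<dots> = a"
    using a unfolding eq by (intro simplex_vertex_const_simplex) (auto simp: graph_auts_def)
  finally have "simplex_vertex T F (\<theta> 0) = a" .
  then show "F = const_simplex T n a"
    using stiff_simplex_at_aut_const[OF T stiff F ord_maps_le[OF \<theta>, of 0]] a by simp
qed (simp add: pull_Sing_const_simplex[OF \<theta>])

text \<open>Being the constant simplex at a given automorphism is unchanged by structure maps, in both
  directions, and hence constant on path components: an automorphism is an isolated point.\<close>

lemma stiff_path_component_at_aut:
  assumes T: "is_graph T" and stiff: "stiff T" and a: "a \<in> graph_auts T"
    and L: "pull L = pull (Sing T ra T)"
      "\<And>n. simps_of L n = graph_hom (graph_prod T (Sigma_graph n)) T"
    and b: "b \<in> graph_hom T T"
    and t: "t \<in> standard_simplex n" and t': "t' \<in> standard_simplex n'"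
    and path: "path_component_of (realization L)
      (realization_class L (n, const_simplex T n a, t))
      (realization_class L (n', const_simplex T n' b, t'))"
  shows "b = a"
proof -
  have a': "a \<in> graph_hom T T" using a by (simp add: graph_auts_def)
  have "(const_simplex T n a = const_simplex T n a) = (const_simplex T n' b = const_simplex T n' a)"
  proof (rule path_component_realization_invariant[OF _ path _ t _ t',
        where c = "\<lambda>n F. F = const_simplex T n a"])
    show "(pull L m n \<theta> F = const_simplex T m a) = (F = const_simplex T n a)"
      if "\<theta> \<in> ord_maps m n" "F \<in> simps_of L n" for m n \<theta> F
      using stiff_pull_Sing_eq_const_iff[OF T stiff a that(1)] that(2) by (simp add: L)
  qed (use const_simplex_in_Sing[OF T] a' b L(2) in auto)
  then have "simplex_vertex T (const_simplex T n' b) 0 = simplex_vertex T (const_simplex T n' a) 0"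
    by simp
  then show ?thesis
    using simplex_vertex_const_simplex[of _ T T 0 n'] a' b by simp
qed

section \<open>The comparison map\<close>

lemma act_simp_map_eq_const_simplex:
  "act_simp_map T ra n \<gamma> = const_simplex T n (act_hom T ra \<gamma>)"
  by (simp add: act_simp_map_def const_simplex_def)

text \<open>By rigidity, taking the initial vertex inverts the formation of constant simplices, so in every
  degree the simplices of \<open>Sing(T,T)\<close> correspond to automorphisms and, through \<open>\<alpha>\<close>, to elements of
  \<open>\<Gamma>\<close>.\<close>

lemma stiff_iso_imp_gweak_equivalence:
  assumes "group \<Gamma>" and T: "is_graph T" and "right_graph_action \<Gamma> T ra" and stiff: "stiff T"
    and iso: "act_hom T ra \<in> iso \<Gamma> (Aut T)" and end_aut: "graph_hom T T \<subseteq> graph_auts T"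
  shows "gweak_equivalence \<Gamma> (discrete_gsimp_set \<Gamma>) (Sing T ra T) (act_simp_map T ra)"
proof (rule levelwise_bij_imp_gweak_equivalence[OF is_gsimp_map_act_simp_map[OF assms(1-3)]])
  fix n
  let ?\<alpha> = "act_hom T ra"
  have bij: "bij_betw ?\<alpha> (carrier \<Gamma>) (graph_auts T)"
    using iso by (simp add: iso_def Aut_def)
  have "bij_betw (const_simplex T n) (graph_auts T) (graph_hom (graph_prod T (Sigma_graph n)) T)"
  proof (rule bij_betw_byWitness[where f' = "\<lambda>F. simplex_vertex T F 0"])
    show "\<forall>a\<in>graph_auts T. simplex_vertex T (const_simplex T n a) 0 = a"
      by (auto simp: graph_auts_def intro: simplex_vertex_const_simplex)
    show vert: "(\<lambda>F. simplex_vertex T F 0) ` graph_hom (graph_prod T (Sigma_graph n)) T \<subseteq> graph_auts T"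
      using simplex_vertex_hom[OF T, of _ n T 0] end_aut by auto
    show "\<forall>F\<in>graph_hom (graph_prod T (Sigma_graph n)) T. const_simplex T n (simplex_vertex T F 0) = F"
      using stiff_simplex_at_aut_const[OF T stiff, of _ n 0] vert by auto
    show "const_simplex T n ` graph_auts T \<subseteq> graph_hom (graph_prod T (Sigma_graph n)) T"
      using const_simplex_in_Sing[OF T] by (auto simp: graph_auts_def)
  qed
  with bij have "bij_betw (const_simplex T n \<circ> ?\<alpha>) (carrier \<Gamma>)
      (graph_hom (graph_prod T (Sigma_graph n)) T)"
    by (rule bij_betw_trans)
  moreover have "const_simplex T n \<circ> ?\<alpha> = act_simp_map T ra n"
    by (simp add: fun_eq_iff act_simp_map_eq_const_simplex)
  ultimately show "bij_betw (act_simp_map T ra n)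
      (simps_of (discrete_gsimp_set \<Gamma>) n) (simps_of (Sing T ra T) n)"
    by (simp add: discrete_gsimp_set_def Sing_def)
qed

text \<open>The bijection on path components at the trivial subgroup gives both conclusions. A component
  met by the comparison map contains exactly one endomorphism, of the form \<open>\<alpha>\<^sub>\<gamma>\<close>. Hitting every
  component thus means that every endomorphism is some \<open>\<alpha>\<^sub>\<gamma>\<close>; hitting each at most once makes \<open>\<alpha>\<close>
  injective.\<close>

lemma stiff_gweak_equivalence_imp_iso:
  assumes "group \<Gamma>" and T: "is_graph T" and act: "right_graph_action \<Gamma> T ra" and stiff: "stiff T"
    and we: "gweak_equivalence \<Gamma> (discrete_gsimp_set \<Gamma>) (Sing T ra T) (act_simp_map T ra)"
  shows "act_hom T ra \<in> iso \<Gamma> (Aut T)" and "graph_hom T T \<subseteq> graph_auts T"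
proof -
  interpret group \<Gamma> by fact
  let ?\<alpha> = "act_hom T ra" and ?f = "act_simp_map T ra"
  let ?K = "fixed_points (discrete_gsimp_set \<Gamma>) {\<one>\<^bsub>\<Gamma>\<^esub>}"
  let ?L = "fixed_points (Sing T ra T) {\<one>\<^bsub>\<Gamma>\<^esub>}"
  let ?F = "realization_map ?L ?f" and ?X = "realization ?K" and ?Y = "realization ?L"
  let ?\<pi> = "\<lambda>C. \<Union>x\<in>C. path_component_of_set ?Y (?F x)"
  define t :: "nat \<Rightarrow> real" where "t = (\<lambda>j. if j = 0 then 1 else 0)"
  have t: "t \<in> standard_simplex 0" by (simp add: t_def)
  let ?x = "\<lambda>\<gamma>. realization_class ?K (0, \<gamma>, t)"
  have "weak_equivalence ?K ?L ?f"
    using we triv_subgroup by (simp add: gweak_equivalence_def)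
  then have f: "is_simp_map ?K ?L ?f" and F: "continuous_map ?X ?Y ?F"
    and bij: "bij_betw ?\<pi> (path_components_of ?X) (path_components_of ?Y)"
    by (simp_all add: weak_equivalence_def weak_homotopy_equivalence_def)
  have K: "simps_of ?K n = carrier \<Gamma>" for n
    by (auto simp: fixed_points_def discrete_gsimp_set_def)
  have L: "simps_of ?L n = graph_hom (graph_prod T (Sigma_graph n)) T" for n
    using is_gsimp_set_Sing[OF assms(1-3), of T]
    by (auto simp: fixed_points_def is_gsimp_set_def Sing_def)
  have pullK: "pull ?K m n \<theta> \<gamma> = \<gamma>" for m n \<theta> \<gamma>
    by (simp add: fixed_points_def discrete_gsimp_set_def)
  have pullL: "pull ?L = pull (Sing T ra T)" by (simp add: fixed_points_def)
  have \<alpha>: "?\<alpha> \<gamma> \<in> graph_auts T" if "\<gamma> \<in> carrier \<Gamma>" for \<gamma>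
    using act that by (simp add: right_graph_action_def)
  have x: "?x \<gamma> \<in> topspace ?X" if "\<gamma> \<in> carrier \<Gamma>" for \<gamma>
    using that t by (intro realization_class_in_topspace) (simp_all add: K)
  have Fclass: "?F (realization_class ?K (n, \<gamma>, s)) =
      realization_class ?L (n, const_simplex T n (?\<alpha> \<gamma>), s)" for n \<gamma> s
    by (simp add: realization_map_class[OF f] act_simp_map_eq_const_simplex)

  have inj: "inj_on ?\<alpha> (carrier \<Gamma>)"
  proof (rule inj_onI)
    fix \<gamma> \<delta> assume \<gamma>: "\<gamma> \<in> carrier \<Gamma>" and \<delta>: "\<delta> \<in> carrier \<Gamma>" and eq: "?\<alpha> \<gamma> = ?\<alpha> \<delta>"
    have "?\<pi> (path_component_of_set ?X (?x \<gamma>)) = ?\<pi> (path_component_of_set ?X (?x \<delta>))"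
      using Union_path_component_of_image[OF F] x \<gamma> \<delta> by (simp add: Fclass eq)
    then have "path_component_of_set ?X (?x \<gamma>) = path_component_of_set ?X (?x \<delta>)"
      using bij x[OF \<gamma>] x[OF \<delta>]
      by (intro inj_onD[OF bij_betw_imp_inj_on[OF bij]]) (simp_all add: path_components_of_def)
    then have "path_component_of ?X (?x \<gamma>) (?x \<delta>)"
      using x[OF \<delta>] by (metis mem_Collect_eq path_component_of_refl)
    then show "\<gamma> = \<delta>"
      using path_component_realization_invariant[of ?K "\<lambda>n \<gamma>. \<gamma>" 0 \<gamma> t 0 \<delta> t] \<gamma> \<delta> t pullK
      by (simp add: K)
  qed

  have hit: "\<exists>\<gamma>\<in>carrier \<Gamma>. a = ?\<alpha> \<gamma>" if a: "a \<in> graph_hom T T" for a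
  proof -
    let ?y = "realization_class ?L (0, const_simplex T 0 a, t)"
    have y: "?y \<in> topspace ?Y"
      using const_simplex_in_Sing[OF T a] t by (intro realization_class_in_topspace) (simp_all add: L)
    then have "path_component_of_set ?Y ?y \<in> ?\<pi> ` path_components_of ?X"
      using bij by (simp add: bij_betw_def path_components_of_def)
    then obtain p where p: "p \<in> topspace ?X"
      and eq: "path_component_of_set ?Y ?y = ?\<pi> (path_component_of_set ?X p)"
      unfolding path_components_of_def by auto
    obtain n \<gamma> s where pn: "p = realization_class ?K (n, \<gamma>, s)"
      and \<gamma>: "\<gamma> \<in> carrier \<Gamma>" and s: "s \<in> standard_simplex n"
      using p by (rule realization_point_cases) (simp add: K)
    have "path_component_of ?Y (?F p) ?y"
      using eq y unfolding Union_path_component_of_image[OF F p]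
      by (metis mem_Collect_eq path_component_of_refl)
    then have "path_component_of ?Y (realization_class ?L (n, const_simplex T n (?\<alpha> \<gamma>), s)) ?y"
      by (simp add: pn Fclass)
    then have "a = ?\<alpha> \<gamma>"
      by (rule stiff_path_component_at_aut[OF T stiff \<alpha>[OF \<gamma>] pullL L a s t])
    with \<gamma> show ?thesis by blast
  qed
  show "graph_hom T T \<subseteq> graph_auts T"
    using hit \<alpha> by blast
  have "?\<alpha> ` carrier \<Gamma> = graph_auts T"
    using hit \<alpha> by (auto simp: graph_auts_def)
  then show "?\<alpha> \<in> iso \<Gamma> (Aut T)"
    using inj act_hom_in_hom[OF act] by (simp add: iso_def bij_betw_def Aut_def)
qed

theorem lemma3p6:
  fixes \<Gamma> :: "('g, 'b) monoid_scheme"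
    and T :: "'v ugraph"
    and ra :: "'v \<Rightarrow> 'g \<Rightarrow> 'v"
  assumes "group \<Gamma>" and "finite (carrier \<Gamma>)"
    and "is_graph T" and "finite (gverts T)" and "graph_connected T" and "gedges T \<noteq> {}"
    and "right_graph_action \<Gamma> T ra"
    and "stiff T"
  shows "gweak_equivalence \<Gamma> (discrete_gsimp_set \<Gamma>) (Sing T ra T) (act_simp_map T ra) \<longleftrightarrow>
         act_hom T ra \<in> iso \<Gamma> (Aut T) \<and> graph_hom T T \<subseteq> carrier (Aut T)"
proof -
  have "carrier (Aut T) = graph_auts T" by (simp add: Aut_def)
  then show ?thesis
    using stiff_iso_imp_gweak_equivalence stiff_gweak_equivalence_imp_iso assms(1,3,7,8) by metis
qed

end
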